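(* For $n=1,2,3,\dots$ let $$L_n=\Big(\bigcup_{i\in\mathbb{Z}}\{n^{-1}i\}\times\mathbb{R}\Big)\cup\Big(\bigcup_{j\in\mathbb{Z}}\mathbb{R}\times\{n^{-1}j\}\Big)\subset\mathbb{R}^2,$$ let $d^L_n$ be the intrinsic metric on $L_n$ induced from the Euclidean metric, and let $d^M((a,b),(x,y))=|x-a|+|y-b|$ be the Manhattan distance on $\mathbb{R}^2$. Then for all $a,b\in\mathbb{R}^2$ and arbitrary sequences $a_n\in L_n$, $b_n\in L_n$ with $d^M(a_n,a)\to0$ and $d^M(b_n,b)\to0$, one has $$d^L_n(a_n,b_n)\to d^M(a,b)\quad\text{as } n\to\infty.$$
   Context: The intrinsic metric $d^L_n(p,q)$ is the infimum of Euclidean lengths of curves contained in $L_n$ joining $p$ and $q$. *)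

theory Defs
  imports "HOL-Analysis.Analysis"
begin

text \<open>The plane is the type \<^typ>\<open>real \<times> real\<close>, whose library distance \<^const>\<open>dist\<close> is the Euclidean
  distance.\<close>

definition grid :: "nat \<Rightarrow> (real \<times> real) set" where
  "grid n = (\<Union>i::int. {inverse (real n) * of_int i} \<times> UNIV) \<union>
            (\<Union>j::int. UNIV \<times> {inverse (real n) * of_int j})"

definition manhattan_dist :: "real \<times> real \<Rightarrow> real \<times> real \<Rightarrow> real" where
  "manhattan_dist p q = \<bar>fst q - fst p\<bar> + \<bar>snd q - snd p\<bar>"

text \<open>The length of a curve parametrised by \<open>[0, 1]\<close> is the supremum of the lengths of inscribed
  polygons, taken over all partitions \<open>0 = t 0 \<le> t 1 \<le> \<dots> \<le> t k = 1\<close>. It is infinite for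
  non-rectifiable curves.\<close>

definition curve_length :: "(real \<Rightarrow> 'a::metric_space) \<Rightarrow> ennreal" where
  "curve_length g =
     (SUP (k, t) \<in> {(k::nat, t::nat \<Rightarrow> real). t 0 = 0 \<and> t k = 1 \<and> mono_on {..k} t}.
        \<Sum>i<k. ennreal (dist (g (t i)) (g (t (Suc i)))))"

text \<open>The infimum is taken in \<^typ>\<open>ennreal\<close>, so it is infinite when no rectifiable curve in the
  set joins the two points.\<close>

definition intrinsic_dist :: "'a::metric_space set \<Rightarrow> 'a \<Rightarrow> 'a \<Rightarrow> ennreal" where
  "intrinsic_dist S p q =
     (INF g \<in> {g. path g \<and> path_image g \<subseteq> S \<and> pathstart g = p \<and> pathfinish g = q}.
        curve_length g)"

end

theory Submission
  imports Defs
begin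

text \<open>
  Cut a curve in the grid into pieces of diameter less than \<open>1 / n\<close>. By connectedness each piece
  either stays on vertical lines, or stays on horizontal lines, or passes through a vertex of the
  grid. As distinct parallel lines are \<open>1 / n\<close> apart, the endpoints of a piece are then joined by an
  inscribed polygon of at most two axis-parallel segments, so the intrinsic distance is at least the
  Manhattan distance. Conversely, going to a nearby vertex, then along an L-shaped path to a vertex
  near the target, and from there to the target, costs at most \<open>4 / n\<close> more than the Manhattan distance.
\<close>

section \<open>Manhattan distance and coordinates of grid lines\<close>

lemma dist_same_fst: "fst p = fst q \<Longrightarrow> dist p q = manhattan_dist p q"
  by (simp add: dist_prod_def manhattan_dist_def dist_real_def)

lemma dist_same_snd: "snd p = snd q \<Longrightarrow> dist p q = manhattan_dist p q"
  by (simp add: dist_prod_def manhattan_dist_def dist_real_def)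

lemma manhattan_dist_triangle: "manhattan_dist p r \<le> manhattan_dist p q + manhattan_dist q r"
  by (simp add: manhattan_dist_def)

lemma manhattan_dist_commute: "manhattan_dist p q = manhattan_dist q p"
  by (simp add: manhattan_dist_def abs_minus_commute)

text \<open>The grid is symmetric under swapping the axes, so one set of admissible coordinates
  serves for both.\<close>

definition grid_line :: "nat \<Rightarrow> real set" where
  "grid_line n = range (\<lambda>i::int. inverse (real n) * of_int i)"

lemma mem_grid_iff: "p \<in> grid n \<longleftrightarrow> fst p \<in> grid_line n \<or> snd p \<in> grid_line n"
  by (cases p) (auto simp: grid_def grid_line_def)

text \<open>Dividing out the mesh width leaves two integers at distance less than 1.\<close>

lemma grid_line_eqI:
  assumes "x \<in> grid_line n" "y \<in> grid_line n" "\<bar>x - y\<bar> < inverse (real n)"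
  shows "x = y"
proof -
  obtain i j :: int where x: "x = inverse (real n) * of_int i" and y: "y = inverse (real n) * of_int j"
    using assms by (auto simp: grid_line_def)
  \<comment> \<open>Since \<open>inverse 0 = 0\<close>, the strict bound already rules out
    \<open>n = 0\<close>.\<close>
  have n: "real n > 0"
    using assms(3) by (cases "n = 0") auto
  have "inverse (real n) * \<bar>of_int (i - j)\<bar> < inverse (real n) * 1"
    using assms(3) n by (simp add: x y abs_mult flip: right_diff_distrib)
  then have "\<bar>real_of_int (i - j)\<bar> < 1"
    using n by (subst (asm) mult_less_cancel_left_pos) auto
  then have "i = j"
    by linarith
  then show ?thesis by (simp add: x y)
qed

text \<open>A scaled copy of the closed set of integers. Closedness is what lets connectedness be
  applied to preimages under a curve.\<close>

lemma closed_grid_line: "closed (grid_line n)"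
proof -
  have "closed ((*) (inverse (real n)) ` \<int>)"
    using closed_scaling[of "\<int> :: real set" "inverse (real n)", OF closed_Ints]
    by (simp only: real_scaleR_def)
  moreover have "grid_line n = (*) (inverse (real n)) ` \<int>"
    by (auto simp: grid_line_def Ints_def)
  ultimately show ?thesis by simp
qed

section \<open>Lower bound: curves in the grid are at least as long as the Manhattan
  distance\<close>

text \<open>A real-valued certificate for the part of the curve over \<open>{0..s}\<close>. The free
  end \<open>s\<close> allows a polygon to be grown node by node, with no supremum or
  \<open>ennreal\<close> arithmetic until the end.\<close>

definition inscribed_length_ge :: "(real \<Rightarrow> 'a::metric_space) \<Rightarrow> real \<Rightarrow> real \<Rightarrow> bool" where
  "inscribed_length_ge g s l \<longleftrightarrow>
     (\<exists>k t. t 0 = 0 \<and> t k = s \<and> mono_on {..k::nat} t \<and> l \<le> (\<Sum>i<k. dist (g (t i)) (g (t (Suc i)))))"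

lemma inscribed_length_ge_0: "inscribed_length_ge g 0 0"
  unfolding inscribed_length_ge_def
  by (rule exI[of _ 0], rule exI[of _ "\<lambda>_. 0"]) (auto simp: mono_on_def)

text \<open>Append \<open>u\<close> as the last node; the polygon gains one edge. The slack in
  \<open>l'\<close> leaves room for the triangle inequality.\<close>

lemma inscribed_length_ge_extend:
  assumes "inscribed_length_ge g s l" "s \<le> u" "l' \<le> l + dist (g s) (g u)"
  shows "inscribed_length_ge g u l'"
proof -
  obtain k t where t: "t 0 = 0" "t k = s" "mono_on {..k::nat} t"
    "l \<le> (\<Sum>i<k. dist (g (t i)) (g (t (Suc i))))"
    using assms(1) by (auto simp: inscribed_length_ge_def)
  define t' where "t' = t(Suc k := u)"
  have "t' i \<le> t' j" if "i \<le> j" "j \<le> Suc k" for i j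
  proof (cases "j = Suc k")
    case True
    show ?thesis
    proof (cases "i = Suc k")
      case False
      then have "t i \<le> t k"
        using that t(3) by (auto simp: mono_on_def)
      then show ?thesis
        using True False assms(2) t(2) by (simp add: t'_def)
    qed (simp add: True)
  next
    case False
    then show ?thesis
      using that t(3) by (auto simp: t'_def mono_on_def)
  qed
  then have "mono_on {..Suc k} t'"
    by (auto simp: mono_on_def)
  moreover have "l' \<le> (\<Sum>i<Suc k. dist (g (t' i)) (g (t' (Suc i))))"
    using assms(3) t(2,4) by (simp add: t'_def)
  ultimately show ?thesis
    unfolding inscribed_length_ge_def
    by (intro exI[of _ "Suc k"] exI[of _ t']) (simp add: t'_def t)
qed

lemma curve_length_ge:
  assumes "inscribed_length_ge g 1 l"
  shows "ennreal l \<le> curve_length g"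
proof -
  obtain k t where t: "t 0 = 0" "t k = 1" "mono_on {..k::nat} t"
    "l \<le> (\<Sum>i<k. dist (g (t i)) (g (t (Suc i))))"
    using assms by (auto simp: inscribed_length_ge_def)
  have "ennreal l \<le> (\<Sum>i<k. ennreal (dist (g (t i)) (g (t (Suc i)))))"
    using t(4) by (subst sum_ennreal) (auto intro: ennreal_leI)
  also have "\<dots> \<le> curve_length g"
    unfolding curve_length_def using t by (intro SUP_upper2[of "(k, t)"]) auto
  finally show ?thesis .
qed

text \<open>The parameters lying over vertical lines (\<open>A\<close>) and over horizontal lines
  (\<open>B\<close>) form two closed sets covering \<open>{s..u}\<close>. If they meet, a common
  point is a vertex and serves as \<open>v\<close>; otherwise connectedness makes one of them
  empty.\<close>

lemma curve_in_grid_short_step: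
  fixes s u :: real
  assumes "s \<le> u"
    and cont: "continuous_on {s..u} g"
    and g: "g ` {s..u} \<subseteq> grid n"
    and small: "\<And>v w. v \<in> {s..u} \<Longrightarrow> w \<in> {s..u} \<Longrightarrow> dist (g v) (g w) < inverse (real n)"
  shows "\<exists>v\<in>{s..u}. dist (g s) (g v) = manhattan_dist (g s) (g v) \<and>
                    dist (g v) (g u) = manhattan_dist (g v) (g u)"
proof -
  define A where "A = {s..u} \<inter> (\<lambda>t. fst (g t)) -` grid_line n"
  define B where "B = {s..u} \<inter> (\<lambda>t. snd (g t)) -` grid_line n"
  have "closed A" "closed B"
    unfolding A_def B_def
    using continuous_closed_preimage[OF continuous_on_fst[OF cont] closed_atLeastAtMost closed_grid_line]
      continuous_closed_preimage[OF continuous_on_snd[OF cont] closed_atLeastAtMost closed_grid_line]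
    by blast+
  \<comment> \<open>A piece of diameter below the mesh width cannot reach two parallel lines, so
    \<open>A\<close> sees a single vertical line.\<close>
  have same_fst: "fst (g v) = fst (g w)" if "v \<in> A" "w \<in> A" for v w
    using that small[of v w] dist_fst_le[of "g v" "g w"]
    by (intro grid_line_eqI[of _ n]) (auto simp: A_def dist_real_def)
  have same_snd: "snd (g v) = snd (g w)" if "v \<in> B" "w \<in> B" for v w
    using that small[of v w] dist_snd_le[of "g v" "g w"]
    by (intro grid_line_eqI[of _ n]) (auto simp: B_def dist_real_def)
  have axis: "dist (g v) (g w) = manhattan_dist (g v) (g w)"
    if "v \<in> A \<and> w \<in> A \<or> v \<in> B \<and> w \<in> B" for v w
    using that
  proof
    assume "v \<in> A \<and> w \<in> A"
    then show ?thesis by (intro dist_same_fst same_fst) simp_all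
  next
    assume "v \<in> B \<and> w \<in> B"
    then show ?thesis by (intro dist_same_snd same_snd) simp_all
  qed
  have cover: "{s..u} = A \<union> B"
    using g unfolding A_def B_def image_subset_iff mem_grid_iff by blast
  have "s \<in> {s..u}" "u \<in> {s..u}"
    using \<open>s \<le> u\<close> by simp_all
  then have su: "s \<in> A \<union> B" "u \<in> A \<union> B"
    unfolding cover .
  show ?thesis
  proof (cases "A \<inter> B = {}")
    case True
    have "A = {} \<or> B = {}"
      using connected_closedD[OF connected_Icc _ _ \<open>closed A\<close> \<open>closed B\<close>, of s u] cover True by blast
    then have "dist (g s) (g u) = manhattan_dist (g s) (g u)"
      using su axis[of s u] by blast
    then show ?thesis
      \<comment> \<open>The whole piece runs on one line, so \<open>v = u\<close> works and the
        second edge is degenerate.\<close>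
      using \<open>s \<le> u\<close> by (intro bexI[of _ u]) (auto simp: manhattan_dist_def)
  next
    case False
    then obtain v where "v \<in> A" "v \<in> B" by blast
    then show ?thesis
      using su axis[of s v] axis[of v u] cover by (intro bexI[of _ v]) blast+
  qed
qed

text \<open>Uniform continuity gives equal pieces of small diameter. Each adds at most two
  axis-parallel edges, whose Euclidean and Manhattan lengths agree, so the triangle inequality for
  \<open>manhattan_dist\<close> carries the bound along the curve.\<close>

lemma manhattan_dist_le_curve_length:
  assumes "n \<ge> 1" "path g" "path_image g \<subseteq> grid n"
  shows "ennreal (manhattan_dist (pathstart g) (pathfinish g)) \<le> curve_length g"
proof -
  have cont: "continuous_on {0..1} g" and img: "g ` {0..1} \<subseteq> grid n"
    using assms by (auto simp: path_def path_image_def)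
  have "uniformly_continuous_on {0..1} g"
    using cont by (intro compact_uniformly_continuous) auto
  moreover have "0 < inverse (real n)"
    using assms(1) by simp
  ultimately obtain d where d: "d > 0"
    "\<And>v w. v \<in> {0..1} \<Longrightarrow> w \<in> {0..1} \<Longrightarrow> dist w v < d \<Longrightarrow> dist (g w) (g v) < inverse (real n)"
    by (rule uniformly_continuous_onE) blast
  \<comment> \<open>Extends the polygon twice, first to the intermediate node \<open>v\<close> and
    then to \<open>u\<close>.\<close>
  have step: "inscribed_length_ge g u (manhattan_dist (g 0) (g u))"
    if "inscribed_length_ge g s (manhattan_dist (g 0) (g s))" "0 \<le> s" "s \<le> u" "u \<le> 1" "u - s < d" for s u
  proof -
    have sub: "{s..u} \<subseteq> {0..1}"
      using that by auto
    have small: "dist (g v) (g w) < inverse (real n)" if "v \<in> {s..u}" "w \<in> {s..u}" for v w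
    proof (rule d(2))
      show "dist v w < d"
        using that \<open>u - s < d\<close> by (auto simp: dist_real_def)
    qed (use that sub in auto)
    have "g ` {s..u} \<subseteq> grid n"
      using img sub by blast
    then obtain v where v: "v \<in> {s..u}" "dist (g s) (g v) = manhattan_dist (g s) (g v)"
      "dist (g v) (g u) = manhattan_dist (g v) (g u)"
      using curve_in_grid_short_step[OF \<open>s \<le> u\<close> continuous_on_subset[OF cont sub] _ small] by blast
    have "inscribed_length_ge g v (manhattan_dist (g 0) (g v))"
      using inscribed_length_ge_extend[OF that(1)] v manhattan_dist_triangle by auto
    then show ?thesis
      using inscribed_length_ge_extend[of g v _ u] v manhattan_dist_triangle by auto
  qed
  obtain N :: nat where N: "N > 0" "inverse (real N) < d"
    using d(1) ex_inverse_of_nat_less by blast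
  have "inscribed_length_ge g (real i / real N) (manhattan_dist (g 0) (g (real i / real N)))"
    if "i \<le> N" for i
    using that
  proof (induction i)
    case 0
    then show ?case
      using inscribed_length_ge_0[of g] by (simp add: manhattan_dist_def)
  next
    case (Suc i)
    show ?case
      \<comment> \<open>Successive nodes are \<open>1 / real N\<close> apart, which is below
        \<open>d\<close>.\<close>
      using Suc N by (intro step[OF Suc.IH]) (auto simp: field_simps)
  qed
  from this[of N] have "inscribed_length_ge g 1 (manhattan_dist (g 0) (g 1))"
    using N(1) by simp
  then show ?thesis
    unfolding pathstart_def pathfinish_def by (rule curve_length_ge)
qed

section \<open>Upper bounds on the intrinsic distance from Lipschitz curves\<close>

text \<open>Using \<open>{0..l}\<close> as domain with Lipschitz constant 1 makes lengths add under
  concatenation without reparametrising. The condition \<open>0 \<le> l\<close> excludes an empty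
  domain.\<close>

definition joined_within :: "'a::metric_space set \<Rightarrow> real \<Rightarrow> 'a \<Rightarrow> 'a \<Rightarrow> bool" where
  "joined_within S l p q \<longleftrightarrow>
     (\<exists>g. 1-lipschitz_on {0..l} g \<and> g ` {0..l} \<subseteq> S \<and> 0 \<le> l \<and> g 0 = p \<and> g l = q)"

text \<open>Shift the second curve by \<open>l\<close>; the two Lipschitz pieces agree at the
  junction \<open>q\<close>, so they glue.\<close>

lemma joined_within_trans:
  assumes "joined_within S l p q" "joined_within S m q r"
  shows "joined_within S (l + m) p r"
proof -
  obtain g where g: "1-lipschitz_on {0..l} g" "g ` {0..l} \<subseteq> S" "0 \<le> l" "g 0 = p" "g l = q"
    using assms(1) by (auto simp: joined_within_def)
  obtain h where h: "1-lipschitz_on {0..m} h" "h ` {0..m} \<subseteq> S" "0 \<le> m" "h 0 = q" "h m = r"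
    using assms(2) by (auto simp: joined_within_def)
  define k where "k = (\<lambda>t. if t \<le> l then g t else h (t - l))"
  have "1-lipschitz_on {l..l + m} (\<lambda>t. h (t - l))"
    using lipschitz_onD[OF h(1), of "x - l" "y - l" for x y]
    by (intro lipschitz_onI) (auto simp: dist_real_def)
  then have "1-lipschitz_on {0..l + m} k"
    unfolding k_def using g h lipschitz_on_concat[of 1 0 l g "l + m" "\<lambda>t. h (t - l)"] by simp
  moreover have "k t \<in> S" if "t \<in> {0..l + m}" for t
    using that g(2) h(2) by (auto simp: k_def image_subset_iff)
  moreover have "k 0 = p" "k (l + m) = r"
    using g h by (auto simp: k_def)
  ultimately show ?thesis
    unfolding joined_within_def using g(3) h(3) by (intro exI[of _ k]) auto
qed

text \<open>The unit-speed parametrisation is an isometry. The case \<open>p = q\<close> is separate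
  because the speed is normalised by \<open>dist p q\<close>.\<close>

lemma joined_within_segment:
  fixes p q :: "'a::real_normed_vector"
  assumes "closed_segment p q \<subseteq> S"
  shows "joined_within S (dist p q) p q"
proof (cases "p = q")
  case True
  then show ?thesis
    using assms by (auto simp: joined_within_def intro!: exI[of _ "\<lambda>_. p"] lipschitz_onI)
next
  case False
  define g where "g = (\<lambda>t. p + (t / dist p q) *\<^sub>R (q - p))"
  have "dist (g s) (g t) = dist s t" for s t
  proof -
    have "g s - g t = ((s - t) / dist p q) *\<^sub>R (q - p)"
      by (simp add: g_def diff_divide_distrib scaleR_left_diff_distrib)
    then show ?thesis
      using False by (simp add: dist_norm norm_minus_commute)
  qed
  then have "1-lipschitz_on {0..dist p q} g"
    by (intro lipschitz_onI) auto
  moreover have "g t \<in> closed_segment p q" if "t \<in> {0..dist p q}" for t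
    using that False unfolding in_segment
    by (intro exI[of _ "t / dist p q"]) (auto simp: g_def algebra_simps)
  ultimately show ?thesis
    unfolding joined_within_def using assms False
    by (intro exI[of _ g]) (auto simp: g_def)
qed

text \<open>Each edge is at most \<open>l\<close> times its parameter increment, and the increments
  telescope to 1.\<close>

lemma curve_length_le_lipschitz:
  assumes "l-lipschitz_on {0..1} g"
  shows "curve_length g \<le> ennreal l"
proof -
  have l: "0 \<le> l"
    using assms lipschitz_on_nonneg by blast
  have "(\<Sum>i<k. ennreal (dist (g (t i)) (g (t (Suc i))))) \<le> ennreal l"
    if t: "t 0 = 0" "t k = 1" "mono_on {..k} t" for k :: nat and t
  proof -
    have t01: "t i \<in> {0..1}" if "i \<le> k" for i
      using that t mono_onD[OF t(3), of 0 i] mono_onD[OF t(3), of i k] by auto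
    have "dist (g (t i)) (g (t (Suc i))) \<le> l * (t (Suc i) - t i)" if "i < k" for i
      using lipschitz_onD[OF assms t01[of i] t01[of "Suc i"]] mono_onD[OF t(3), of i "Suc i"] that
      by (simp add: dist_real_def)
    then have "(\<Sum>i<k. dist (g (t i)) (g (t (Suc i)))) \<le> (\<Sum>i<k. l * (t (Suc i) - t i))"
      by (intro sum_mono) auto
    also have "\<dots> = l"
      using t by (simp add: sum_lessThan_telescope flip: sum_distrib_left)
    finally show ?thesis
      by (subst sum_ennreal) (auto intro: ennreal_leI)
  qed
  then show ?thesis
    unfolding curve_length_def by (intro SUP_least) auto
qed

text \<open>Rescaling \<open>{0..l}\<close> to the unit interval turns the Lipschitz constant 1 into
  \<open>l\<close>, which then bounds the length.\<close>

lemma intrinsic_dist_le: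
  assumes "joined_within S l p q"
  shows "intrinsic_dist S p q \<le> ennreal l"
proof -
  obtain g where g: "1-lipschitz_on {0..l} g" "g ` {0..l} \<subseteq> S" "0 \<le> l" "g 0 = p" "g l = q"
    using assms by (auto simp: joined_within_def)
  define h where "h = (\<lambda>t. g (l * t))"
  have range: "l * t \<in> {0..l}" if "t \<in> {0..1}" for t
    using that g(3) by (auto intro: mult_left_le)
  have "dist (h s) (h t) \<le> l * dist s t" if "s \<in> {0..1}" "t \<in> {0..1}" for s t
    using lipschitz_onD[OF g(1) range[OF that(1)] range[OF that(2)]] g(3)
    by (simp add: h_def dist_real_def abs_mult flip: right_diff_distrib)
  then have lip: "l-lipschitz_on {0..1} h"
    using g(3) by (intro lipschitz_onI)
  then have "path h"
    by (auto simp: path_def intro: lipschitz_on_continuous_on)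
  moreover have "path_image h \<subseteq> S"
    using g(2) range by (auto simp: path_image_def h_def image_subset_iff)
  ultimately have "intrinsic_dist S p q \<le> curve_length h"
    unfolding intrinsic_dist_def using g by (intro INF_lower) (auto simp: h_def pathstart_def pathfinish_def)
  also have "\<dots> \<le> ennreal l"
    by (rule curve_length_le_lipschitz[OF lip])
  finally show ?thesis .
qed

section \<open>Explicit paths in the grid\<close>

lemma joined_within_grid_same_fst:
  assumes "fst p = fst q" "fst p \<in> grid_line n"
  shows "joined_within (grid n) (manhattan_dist p q) p q"
proof -
  have "fst z = fst p" if "z \<in> closed_segment p q" for z
  proof -
    obtain u where "z = (1 - u) *\<^sub>R p + u *\<^sub>R q"
      using \<open>z \<in> closed_segment p q\<close> by (auto simp: in_segment)
    then have "fst z = (1 - u) * fst p + u * fst p"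
      using assms(1) by simp
    then show ?thesis
      by (simp add: algebra_simps)
  qed
  then have "closed_segment p q \<subseteq> grid n"
    using assms(2) by (metis mem_grid_iff subsetI)
  then show ?thesis
    unfolding dist_same_fst[OF assms(1), symmetric] by (rule joined_within_segment)
qed

lemma joined_within_grid_same_snd:
  assumes "snd p = snd q" "snd p \<in> grid_line n"
  shows "joined_within (grid n) (manhattan_dist p q) p q"
proof -
  have "snd z = snd p" if "z \<in> closed_segment p q" for z
  proof -
    obtain u where "z = (1 - u) *\<^sub>R p + u *\<^sub>R q"
      using \<open>z \<in> closed_segment p q\<close> by (auto simp: in_segment)
    then have "snd z = (1 - u) * snd p + u * snd p"
      using assms(1) by simp
    then show ?thesis
      by (simp add: algebra_simps)
  qed
  then have "closed_segment p q \<subseteq> grid n"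
    using assms(2) by (metis mem_grid_iff subsetI)
  then show ?thesis
    unfolding dist_same_snd[OF assms(1), symmetric] by (rule joined_within_segment)
qed

text \<open>Round \<open>x\<close> down to a multiple of the mesh width.\<close>

lemma grid_line_near:
  assumes "n \<ge> 1"
  obtains y where "y \<in> grid_line n" "\<bar>y - x\<bar> \<le> inverse (real n)"
proof
  define y where "y = inverse (real n) * of_int \<lfloor>real n * x\<rfloor>"
  show "y \<in> grid_line n"
    by (auto simp: y_def grid_line_def)
  have "y - x = inverse (real n) * (of_int \<lfloor>real n * x\<rfloor> - real n * x)"
    using assms by (simp add: y_def field_simps)
  moreover have "\<bar>of_int \<lfloor>real n * x\<rfloor> - real n * x\<bar> \<le> 1"
    by linarith
  ultimately show "\<bar>y - x\<bar> \<le> inverse (real n)"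
    by (simp add: abs_mult mult_left_le)
qed

text \<open>Slide along a grid line through \<open>p\<close>, rounding the other coordinate. Both
  directions are recorded because a path leaves its start towards a vertex and reaches its end from
  one.\<close>

lemma joined_within_vertex:
  assumes "n \<ge> 1" "p \<in> grid n"
  obtains v where "fst v \<in> grid_line n" "snd v \<in> grid_line n"
    "manhattan_dist p v \<le> inverse (real n)"
    "joined_within (grid n) (manhattan_dist p v) p v"
    "joined_within (grid n) (manhattan_dist p v) v p"
proof (cases "fst p \<in> grid_line n")
  case True
  obtain y where y: "y \<in> grid_line n" "\<bar>y - snd p\<bar> \<le> inverse (real n)"
    using grid_line_near[OF assms(1)] .
  define v where "v = (fst p, y)"
  have pv: "joined_within (grid n) (manhattan_dist p v) p v"
    and vp: "joined_within (grid n) (manhattan_dist v p) v p"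
    using True by (auto simp: v_def intro!: joined_within_grid_same_fst)
  show thesis
  proof (rule that)
    show "manhattan_dist p v \<le> inverse (real n)"
      using y(2) by (simp add: v_def manhattan_dist_def)
    show "joined_within (grid n) (manhattan_dist p v) v p"
      using vp by (subst manhattan_dist_commute)
  qed (use True y(1) pv in \<open>simp_all add: v_def\<close>)
next
  case False
  then have p: "snd p \<in> grid_line n"
    using assms(2) by (simp add: mem_grid_iff)
  obtain x where x: "x \<in> grid_line n" "\<bar>x - fst p\<bar> \<le> inverse (real n)"
    using grid_line_near[OF assms(1)] .
  define v where "v = (x, snd p)"
  have pv: "joined_within (grid n) (manhattan_dist p v) p v"
    and vp: "joined_within (grid n) (manhattan_dist v p) v p"
    using p by (auto simp: v_def intro!: joined_within_grid_same_snd)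
  show thesis
  proof (rule that)
    show "manhattan_dist p v \<le> inverse (real n)"
      using x(2) by (simp add: v_def manhattan_dist_def)
    show "joined_within (grid n) (manhattan_dist p v) v p"
      using vp by (subst manhattan_dist_commute)
  qed (use p x(1) pv in \<open>simp_all add: v_def\<close>)
qed

section \<open>Comparison of the two distances and the limit\<close>

lemma manhattan_dist_le_intrinsic_dist:
  assumes "n \<ge> 1"
  shows "ennreal (manhattan_dist p q) \<le> intrinsic_dist (grid n) p q"
  unfolding intrinsic_dist_def
  using manhattan_dist_le_curve_length[OF assms] by (intro INF_greatest) auto

lemma intrinsic_dist_le_manhattan_dist:
  assumes "n \<ge> 1" "p \<in> grid n" "q \<in> grid n"
  shows "intrinsic_dist (grid n) p q \<le> ennreal (manhattan_dist p q + 4 * inverse (real n))"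
proof -
  obtain v where v: "snd v \<in> grid_line n" "manhattan_dist p v \<le> inverse (real n)"
    "joined_within (grid n) (manhattan_dist p v) p v"
    using joined_within_vertex[OF assms(1,2)] by blast
  obtain w where w: "fst w \<in> grid_line n" "manhattan_dist q w \<le> inverse (real n)"
    "joined_within (grid n) (manhattan_dist q w) w q"
    using joined_within_vertex[OF assms(1,3)] by blast
  \<comment> \<open>The corner of the L: on the horizontal line through \<open>v\<close> and the
    vertical line through \<open>w\<close>. Both legs stay in the grid, and passing through
    \<open>c\<close> costs no extra Manhattan length.\<close>
  define c where "c = (fst w, snd v)"
  have vc: "joined_within (grid n) (manhattan_dist v c) v c"
    using v(1) by (intro joined_within_grid_same_snd) (auto simp: c_def)
  have cw: "joined_within (grid n) (manhattan_dist c w) c w"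
    using w(1) by (intro joined_within_grid_same_fst) (auto simp: c_def)
  have "manhattan_dist v c + manhattan_dist c w = manhattan_dist v w"
    by (simp add: c_def manhattan_dist_def)
  moreover have "manhattan_dist v w \<le> manhattan_dist p v + manhattan_dist p q + manhattan_dist q w"
    using manhattan_dist_triangle[of v w p] manhattan_dist_triangle[of p w q]
    by (simp add: manhattan_dist_commute[of v p])
  \<comment> \<open>Two mesh widths pay for the walks to and from the vertices, two more for
    replacing \<open>p\<close>, \<open>q\<close> by \<open>v\<close>, \<open>w\<close>.\<close>
  ultimately have "manhattan_dist p v + manhattan_dist v c + manhattan_dist c w + manhattan_dist q w
      \<le> manhattan_dist p q + 4 * inverse (real n)"
    using v(2) w(2) by linarith
  then show ?thesis
    using intrinsic_dist_le[OF joined_within_trans[OF joined_within_trans[OF joined_within_trans[OF v(3) vc] cw] w(3)]]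
    by (meson ennreal_leI order_trans)
qed

text \<open>Moving each endpoint changes the distance by at most the Manhattan length of the
  move.\<close>

lemma tendsto_manhattan_dist:
  assumes "(\<lambda>n. manhattan_dist (p n) a) \<longlonglongrightarrow> 0" "(\<lambda>n. manhattan_dist (q n) b) \<longlonglongrightarrow> 0"
  shows "(\<lambda>n. manhattan_dist (p n) (q n)) \<longlonglongrightarrow> manhattan_dist a b"
proof -
  have bound: "norm (manhattan_dist (p n) (q n) - manhattan_dist a b)
      \<le> manhattan_dist (p n) a + manhattan_dist (q n) b" for n
    using manhattan_dist_triangle[of "p n" "q n" a] manhattan_dist_triangle[of a "q n" b]
      manhattan_dist_triangle[of a b "p n"] manhattan_dist_triangle[of "p n" b "q n"]
      manhattan_dist_commute[of a "p n"] manhattan_dist_commute[of b "q n"]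
    unfolding real_norm_def by linarith
  have "(\<lambda>n. manhattan_dist (p n) a + manhattan_dist (q n) b) \<longlonglongrightarrow> 0"
    using tendsto_add[OF assms] by simp
  then have "(\<lambda>n. manhattan_dist (p n) (q n) - manhattan_dist a b) \<longlonglongrightarrow> 0"
    by (rule Lim_null_comparison[OF always_eventually[OF allI[OF bound]]])
  then show ?thesis
    by (rule LIM_zero_cancel)
qed

theorem theorem6p1:
  fixes a b :: "real \<times> real" and a_seq b_seq :: "nat \<Rightarrow> real \<times> real"
  assumes "\<And>n. n \<ge> 1 \<Longrightarrow> a_seq n \<in> grid n"
    and "\<And>n. n \<ge> 1 \<Longrightarrow> b_seq n \<in> grid n"
    and "(\<lambda>n. manhattan_dist (a_seq n) a) \<longlonglongrightarrow> 0"
    and "(\<lambda>n. manhattan_dist (b_seq n) b) \<longlonglongrightarrow> 0"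
  shows "(\<lambda>n. intrinsic_dist (grid n) (a_seq n) (b_seq n)) \<longlonglongrightarrow> ennreal (manhattan_dist a b)"
proof (rule tendsto_sandwich)
  \<comment> \<open>Both outer sequences converge to the claimed limit. The two inequalities hold
    from \<open>n = 1\<close> on, so index 0 is discarded by
    \<open>eventually_ge_at_top\<close>.\<close>
  have lim: "(\<lambda>n. manhattan_dist (a_seq n) (b_seq n)) \<longlonglongrightarrow> manhattan_dist a b"
    using assms(3,4) by (rule tendsto_manhattan_dist)
  then show "(\<lambda>n. ennreal (manhattan_dist (a_seq n) (b_seq n))) \<longlonglongrightarrow> ennreal (manhattan_dist a b)"
    by (rule tendsto_ennrealI)
  have "(\<lambda>n. manhattan_dist (a_seq n) (b_seq n) + 4 * inverse (real n)) \<longlonglongrightarrow> manhattan_dist a b + 4 * 0"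
    by (intro tendsto_intros lim lim_inverse_n)
  then show "(\<lambda>n. ennreal (manhattan_dist (a_seq n) (b_seq n) + 4 * inverse (real n)))
      \<longlonglongrightarrow> ennreal (manhattan_dist a b)"
    by (intro tendsto_ennrealI) simp
  show "\<forall>\<^sub>F n in sequentially. ennreal (manhattan_dist (a_seq n) (b_seq n))
      \<le> intrinsic_dist (grid n) (a_seq n) (b_seq n)"
    using eventually_ge_at_top[of 1] by eventually_elim (rule manhattan_dist_le_intrinsic_dist)
  show "\<forall>\<^sub>F n in sequentially. intrinsic_dist (grid n) (a_seq n) (b_seq n)
      \<le> ennreal (manhattan_dist (a_seq n) (b_seq n) + 4 * inverse (real n))"
    using eventually_ge_at_top[of 1]
    by eventually_elim (intro intrinsic_dist_le_manhattan_dist assms(1,2))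
qed

end
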